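(* Let $a_1,a_2,\dots$ be a non-decreasing sequence of positive integers with $a_n\to\infty$. Let $\xi_1,\xi_2,\dots$ be i.i.d. two-dimensional Rademacher random variables and let $S_n=\sum_{i=1}^n a_i\xi_i$. Then the walk $S_n$ is transient.
   Context: Let $\mathbf{e}_1=(1,0)$, $\mathbf{e}_2=(0,1)$. A random vector $\xi$ has the two-dimensional Rademacher distribution if it takes each of the values $\mathbf{e}_1,\mathbf{e}_2,-\mathbf{e}_1,-\mathbf{e}_2$ with probability $1/4$. For a deterministic sequence $(a_n)$ of positive real numbers and i.i.d. two-dimensional Rademacher variables $\xi_1,\xi_2,\dots$, the two-dimensional Rademacher walk is $S_n=\sum_{i=1}^n a_i\xi_i$. The walk is called transient if $\|S_n\|\to\infty$ almost surely. *)

theory Defs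
  imports "HOL-Probability.Probability"
begin

definition rademacher2 :: "'w measure \<Rightarrow> ('w \<Rightarrow> real \<times> real) \<Rightarrow> bool" where
  "rademacher2 M X \<longleftrightarrow> X \<in> borel_measurable M \<and>
     (\<forall>v \<in> {(1, 0), (0, 1), - (1, 0), - (0, 1)}. measure M {\<omega> \<in> space M. X \<omega> = v} = 1 / 4)"

(* Indices start at 1; the values of a and \<xi> at index 0 are never used. *)
definition iid_rademacher2 :: "'w measure \<Rightarrow> (nat \<Rightarrow> 'w \<Rightarrow> real \<times> real) \<Rightarrow> bool" where
  "iid_rademacher2 M \<xi> \<longleftrightarrow>
     prob_space.indep_vars M (\<lambda>_. borel) \<xi> {1..} \<and> (\<forall>i\<ge>1. rademacher2 M (\<xi> i))"

definition rademacher_walk ::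
  "(nat \<Rightarrow> real) \<Rightarrow> (nat \<Rightarrow> 'w \<Rightarrow> real \<times> real) \<Rightarrow> nat \<Rightarrow> 'w \<Rightarrow> real \<times> real" where
  "rademacher_walk a \<xi> n \<omega> = (\<Sum>i = 1..n. a i *\<^sub>R \<xi> i \<omega>)"

(* The norm on real \<times> real is the Euclidean one. *)
definition transient :: "'w measure \<Rightarrow> (nat \<Rightarrow> 'w \<Rightarrow> real \<times> real) \<Rightarrow> bool" where
  "transient M S \<longleftrightarrow> (AE \<omega> in M. filterlim (\<lambda>n. norm (S n \<omega>)) at_top sequentially)"

end

(* Group the times n by the common value b of a n. Within one group S changes by multiples of b
   only, so a visit to x forces S to be congruent to x modulo b at the start of the group. The
   rotated coordinates S1 + S2 and S1 - S2 have independent signs as increments, hence by Fourier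
   analysis on Z/b this congruence has probability at most
     (1/b * sum over t < b of prod over c in A of |cos (2 pi t c / b)|)^2,
   where A is the set of values of a below b. Put k = card A and let s(t) be the sum over c in A
   of cos (4 pi t c / b). The product is at most exp (- (k - s(t)) / 4), which is O(1/k) unless
   s(t) > k/2, and in that case it is at most 1 <= 4 s(t)^2 / k^2. As the elements of A are
   distinct modulo b, the mean of s(t)^2 is at most 3k by orthogonality. The probability is
   therefore O(1/k^2), where k numbers the groups, and Borel-Cantelli over the groups (not over
   the times, where the sum may diverge) shows that every point is visited finitely often. *)
theory Submission
  imports Defs
begin

section \<open>Orthogonality of the characters of Z/b\<close>

text \<open>This is a geometric sum over the powers of a \<open>b\<close>-th root of unity
  \<open>z\<close>, and \<open>z = 1\<close> exactly when \<open>b\<close> divides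
  \<open>m\<close>.\<close>

lemma sum_cis_roots_of_unity:
  fixes b :: nat and m :: int
  assumes "b > 0"
  shows "(\<Sum>t<b. cis (2 * pi * real t * of_int m / real b)) = (if int b dvd m then of_nat b else 0)"
proof -
  define z where "z = cis (2 * pi * of_int m / real b)"
  have pow: "cis (2 * pi * real t * of_int m / real b) = z ^ t" for t
    by (simp add: z_def Complex.DeMoivre mult_ac)
  have "z ^ b = cis (2 * pi * of_int m)"
    using assms unfolding z_def by (simp add: Complex.DeMoivre)
  then have zb: "z ^ b = 1"
    by (simp add: cis_multiple_2pi)
  show ?thesis
  proof (cases "int b dvd m")
    case True
    then obtain q where "m = int b * q" ..
    then have "2 * pi * of_int m / real b = 2 * pi * of_int q"
      using assms by simp
    then have "z = 1" by (simp only: z_def cis_multiple_2pi Ints_of_int)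
    then show ?thesis using True by (simp only: pow) simp
  next
    case False
    have "z \<noteq> 1"
    proof
      assume "z = 1"
      then have "cos (2 * pi * of_int m / real b) = 1"
        unfolding z_def by (metis cis.simps(1) one_complex.simps(1))
      then obtain q :: int where "2 * pi * of_int m / real b = of_int q * 2 * pi"
        unfolding cos_one_2pi_int by auto
      then have "real_of_int m = of_int (q * int b)"
        using assms by (simp add: field_simps)
      then have "m = q * int b" by (simp only: of_int_eq_iff)
      then show False using False by simp
    qed
    then have "(\<Sum>t<b. z ^ t) = 0"
      using zb by (simp add: geometric_sum)
    then show ?thesis using False by (simp only: pow) simp
  qed
qed

lemma sum_cos_roots_of_unity:
  fixes b :: nat and m :: int
  assumes "b > 0"
  shows "(\<Sum>t<b. cos (2 * pi * real t * of_int m / real b)) = (if int b dvd m then real b else 0)"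
proof -
  have "(\<Sum>t<b. cos (2 * pi * real t * of_int m / real b))
      = Re (\<Sum>t<b. cis (2 * pi * real t * of_int m / real b))"
    by simp
  then show ?thesis
    unfolding sum_cis_roots_of_unity[OF assms] by simp
qed

section \<open>Products of cosines, averaged over the residues modulo b\<close>

text \<open>After squaring, this is \<open>1 - y \<le> exp (- y)\<close> at the squared sine of
  \<open>x\<close>, which equals \<open>(1 - cos (2 * x)) / 2\<close>. It turns a product of cosines
  into the exponential of a cosine sum, whose second moment is computable.\<close>

lemma abs_cos_le_exp: "\<bar>cos x\<bar> \<le> exp (- (1 - cos (2 * x)) / 4)" for x :: real
proof (rule power2_le_imp_le)
  have "(cos x)\<^sup>2 = 1 + - (sin x)\<^sup>2" by (simp add: cos_squared_eq)
  also have "\<dots> \<le> exp (- (sin x)\<^sup>2)" by (rule exp_ge_add_one_self)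
  also have "\<dots> = (exp (- (1 - cos (2 * x)) / 4))\<^sup>2"
    by (simp add: cos_double_sin flip: exp_double)
  finally show "\<bar>cos x\<bar>\<^sup>2 \<le> (exp (- (1 - cos (2 * x)) / 4))\<^sup>2" by simp
qed simp

text \<open>Each summand on the right covers one case. If the cosine sum is at most half of
  \<open>card A\<close>, exponential decay beats the first summand; otherwise the second is at least
  1, a trivial bound for the product. Adding both gives a bound that can be summed over all
  frequencies without a case distinction.\<close>

lemma prod_abs_cos_le:
  fixes f :: "'a \<Rightarrow> real"
  assumes "card A > 0"
  shows "(\<Prod>c\<in>A. \<bar>cos (f c)\<bar>)
    \<le> 8 / card A + 4 * (\<Sum>c\<in>A. cos (2 * f c))\<^sup>2 / (real (card A))\<^sup>2"
proof -
  define k s where "k = real (card A)" and "s = (\<Sum>c\<in>A. cos (2 * f c))"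
  have fin: "finite A" and k: "k > 0"
    using assms by (auto simp: k_def card_gt_0_iff)
  have "(\<Prod>c\<in>A. \<bar>cos (f c)\<bar>) \<le> (\<Prod>c\<in>A. exp (- (1 - cos (2 * f c)) / 4))"
    by (intro prod_mono conjI abs_cos_le_exp) simp
  also have "\<dots> = exp (- (k - s) / 4)"
    using fin
    by (simp add: exp_sum[symmetric] k_def s_def sum_divide_distrib[symmetric] sum_subtractf)
  finally have le: "(\<Prod>c\<in>A. \<bar>cos (f c)\<bar>) \<le> exp (- (k - s) / 4)" .
  have "(\<Prod>c\<in>A. \<bar>cos (f c)\<bar>) \<le> 8 / k + 4 * s\<^sup>2 / k\<^sup>2"
  proof (cases "s \<le> k / 2")
    case True
    have "exp (- (k - s) / 4) \<le> exp (- (k / 8))" using True by simp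
    also have "\<dots> \<le> 8 / k"
      using k exp_ge_add_one_self[of "k / 8"] by (simp add: exp_minus field_simps)
    finally show ?thesis using le k by (smt (verit) divide_nonneg_nonneg zero_le_power2)
  next
    case False
    then have "(k / 2)\<^sup>2 \<le> s\<^sup>2" using k by (intro power_mono) auto
    then have "1 \<le> 4 * s\<^sup>2 / k\<^sup>2" using k by (simp add: field_simps power2_eq_square)
    moreover have "(\<Prod>c\<in>A. \<bar>cos (f c)\<bar>) \<le> 1"
      by (intro prod_le_1) auto
    moreover have "8 / k \<ge> 0" using k by simp
    ultimately show ?thesis by linarith
  qed
  then show ?thesis by (simp add: k_def s_def)
qed

text \<open>The window is wide enough for both \<open>2 * (c - d)\<close> and \<open>2 * (c + d)\<close> with \<open>0 < c, d < b\<close>.\<close>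
lemma card_dvd_window_le:
  fixes b :: nat and g :: "nat \<Rightarrow> int"
  assumes "inj_on g D" and "\<And>d. d \<in> D \<Longrightarrow> l * int b < g d \<and> g d < (l + 4) * int b \<and> int b dvd g d"
  shows "card D \<le> 3"
proof -
  \<comment> \<open>Only three multiples of \<open>b\<close> lie strictly inside a window of length
    \<open>4 * b\<close> whose ends are multiples of \<open>b\<close>.\<close>
  have "g ` D \<subseteq> (\<lambda>q. int b * q) ` {l+1..l+3}"
  proof
    fix y assume "y \<in> g ` D"
    then have "int b dvd y" and y: "l * int b < y" "y < (l + 4) * int b"
      using assms(2) by auto
    then obtain q where q: "y = int b * q" by auto
    have "int b > 0" using y by (cases "b = 0") auto
    then have "l < q" "q < l + 4" using y q by (auto simp: mult.commute[of _ "int b"])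
    then show "y \<in> (\<lambda>q. int b * q) ` {l+1..l+3}" using q by auto
  qed
  then have "card (g ` D) \<le> card ((\<lambda>q. int b * q) ` {l+1..l+3})"
    by (intro card_mono) auto
  also have "\<dots> \<le> card {l+1..l+3}" by (intro card_image_le) auto
  finally show ?thesis using card_image[OF assms(1)] by simp
qed

text \<open>Expanding the square and applying orthogonality leaves the pairs with
  \<open>2 * (c - d)\<close> or \<open>2 * (c + d)\<close> divisible by \<open>b\<close>. The
  doubled angle lets pairs with \<open>c \<noteq> d\<close> survive, for instance at distance
  \<open>b / 2\<close>; still, for fixed \<open>c\<close> each condition has at most three solutions
  \<open>d\<close>.\<close>

lemma sum_sum_cos_squared_le:
  fixes b :: nat
  assumes "A \<subseteq> {1..<b}"
  shows "(\<Sum>t<b. (\<Sum>c\<in>A. cos (2 * (2 * pi * real t * real c / real b)))\<^sup>2) \<le> 3 * real b * card A"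
proof -
  have fin: "finite A" using assms finite_subset by blast
  show ?thesis
  proof (cases "b = 0")
    case False
    then have b: "b > 0" by simp
    define I where "I m = (if int b dvd m then real b else 0)" for m :: int
    have cc: "cos (2 * (2 * pi * real t * real c / real b)) * cos (2 * (2 * pi * real t * real d / real b))
      = (cos (2 * pi * real t * of_int (2 * (int c - int d)) / real b)
         + cos (2 * pi * real t * of_int (2 * (int c + int d)) / real b)) / 2" for t c d
      unfolding cos_times_cos by (simp add: algebra_simps diff_divide_distrib add_divide_distrib)
    have card1: "(\<Sum>d\<in>A. I (g d)) \<le> 3 * real b"
      if "inj_on g A" "\<And>d. d \<in> A \<Longrightarrow> l * int b < g d \<and> g d < (l + 4) * int b" for g l
    proof -
      have "(\<Sum>d\<in>A. I (g d)) = real b * card {d\<in>A. int b dvd g d}"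
        using fin by (simp add: I_def sum.If_cases Int_def)
      moreover have "card {d\<in>A. int b dvd g d} \<le> 3"
        by (rule card_dvd_window_le[where g = g and l = l and b = b])
          (use that in \<open>auto intro: inj_on_subset\<close>)
      ultimately show ?thesis by (simp add: mult.commute mult_left_mono)
    qed
    have "(\<Sum>t<b. (\<Sum>c\<in>A. cos (2 * (2 * pi * real t * real c / real b)))\<^sup>2)
      = (\<Sum>t<b. \<Sum>c\<in>A. \<Sum>d\<in>A. (cos (2 * pi * real t * of_int (2 * (int c - int d)) / real b)
         + cos (2 * pi * real t * of_int (2 * (int c + int d)) / real b)) / 2)"
      unfolding power2_eq_square sum_product cc ..
    also have "\<dots> = (\<Sum>c\<in>A. \<Sum>d\<in>A. \<Sum>t<b. (cos (2 * pi * real t * of_int (2 * (int c - int d)) / real b)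
         + cos (2 * pi * real t * of_int (2 * (int c + int d)) / real b)) / 2)"
      by (rule trans[OF sum.swap], rule sum.cong[OF refl], rule sum.swap)
    also have "\<dots> = (\<Sum>c\<in>A. \<Sum>d\<in>A. (I (2 * (int c - int d)) + I (2 * (int c + int d))) / 2)"
      unfolding sum_divide_distrib[symmetric] sum.distrib sum_cos_roots_of_unity[OF b] I_def ..
    also have "\<dots> = (\<Sum>c\<in>A. ((\<Sum>d\<in>A. I (2 * (int c - int d))) + (\<Sum>d\<in>A. I (2 * (int c + int d)))) / 2)"
      by (simp add: sum_divide_distrib[symmetric] sum.distrib)
    also have "\<dots> \<le> (\<Sum>c\<in>A. 3 * real b)"
    proof (rule sum_mono)
      fix c assume "c \<in> A"
      then have c: "1 \<le> c" "c < b" using assms by auto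
      \<comment> \<open>As \<open>c\<close> and \<open>d\<close> lie strictly between 0 and
        \<open>b\<close>, the doubled difference lies between \<open>-2 * b\<close> and
        \<open>2 * b\<close>, and the doubled sum between 0 and \<open>4 * b\<close>; hence the
        window starts -2 and 0.\<close>
      have h1: "(\<Sum>d\<in>A. I (2 * (int c - int d))) \<le> 3 * real b"
        by (rule card1[of _ "-2"]) (use c assms in \<open>auto simp: inj_on_def\<close>)
      have h2: "(\<Sum>d\<in>A. I (2 * (int c + int d))) \<le> 3 * real b"
        by (rule card1[of _ 0]) (use c assms in \<open>auto simp: inj_on_def\<close>)
      show "((\<Sum>d\<in>A. I (2 * (int c - int d))) + (\<Sum>d\<in>A. I (2 * (int c + int d)))) / 2
        \<le> 3 * real b"
        using add_mono[OF h1 h2] by (subst pos_divide_le_eq) (simp_all only: mult_2_right zero_less_numeral)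
    qed
    finally show ?thesis by (simp add: mult_ac)
  qed simp
qed

text \<open>The pointwise bound is summed over the frequencies; the constant is 8 + 4 * 3, with 3
  from the second moment.\<close>

lemma sum_prod_abs_cos_le:
  fixes b :: nat
  assumes "A \<subseteq> {1..<b}" and "card A > 0"
  shows "(\<Sum>t<b. \<Prod>c\<in>A. \<bar>cos (2 * pi * real t * real c / real b)\<bar>) \<le> 20 * real b / card A"
proof -
  define k where "k = real (card A)"
  have k: "k > 0" using assms by (simp add: k_def)
  define s where "s t = (\<Sum>c\<in>A. cos (2 * (2 * pi * real t * real c / real b)))" for t
  have "(\<Sum>t<b. \<Prod>c\<in>A. \<bar>cos (2 * pi * real t * real c / real b)\<bar>) \<le> (\<Sum>t<b. 8 / k + 4 * (s t)\<^sup>2 / k\<^sup>2)"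
    unfolding k_def s_def by (intro sum_mono prod_abs_cos_le assms)
  also have "\<dots> = 8 * real b / k + 4 * (\<Sum>t<b. (s t)\<^sup>2) / k\<^sup>2"
    by (simp add: sum.distrib sum_distrib_left sum_divide_distrib)
  also have "\<dots> \<le> 8 * real b / k + 4 * (3 * real b * k) / k\<^sup>2"
    unfolding s_def k_def
    by (intro add_left_mono divide_right_mono mult_left_mono sum_sum_cos_squared_le assms) auto
  also have "\<dots> = 20 * real b / k" using k by (simp add: field_simps power2_eq_square)
  finally show ?thesis by (simp add: k_def)
qed

section \<open>Characteristic functions of Rademacher vectors\<close>

text \<open>The definition prescribes only four point masses; they add up to 1, so no mass remains
  elsewhere.\<close>

lemma rademacher2_AE:
  assumes "prob_space M" "rademacher2 M X"
  shows "AE \<omega> in M. X \<omega> \<in> {(1, 0), (0, 1), - (1, 0), - (0, 1)}"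
proof -
  interpret prob_space M by fact
  let ?V = "{(1, 0), (0, 1), - (1, 0), - (0, 1)} :: (real \<times> real) set"
  have [measurable]: "X \<in> borel_measurable M"
    and p: "\<And>v. v \<in> ?V \<Longrightarrow> prob {\<omega> \<in> space M. X \<omega> = v} = 1 / 4"
    using assms(2) by (auto simp: rademacher2_def)
  have "prob {\<omega> \<in> space M. X \<omega> \<in> ?V} = prob (\<Union>v\<in>?V. {\<omega> \<in> space M. X \<omega> = v})"
    by (intro arg_cong[where f = prob]) auto
  also have "\<dots> = (\<Sum>v\<in>?V. prob {\<omega> \<in> space M. X \<omega> = v})"
    by (rule finite_measure_finite_Union) (auto simp: disjoint_family_on_def)
  also have "\<dots> = (\<Sum>v\<in>?V. 1 / 4)"
    by (intro sum.cong p refl)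
  also have "\<dots> = 1" by simp
  finally show ?thesis
    by (subst (asm) prob_Collect_eq_1) auto
qed

lemma rademacher2_expectation:
  fixes g :: "real \<times> real \<Rightarrow> complex"
  assumes "prob_space M" "rademacher2 M X" and [measurable]: "g \<in> borel_measurable borel"
  shows "(LINT \<omega>|M. g (X \<omega>)) = (g (1, 0) + g (0, 1) + g (-1, 0) + g (0, -1)) / 4"
proof -
  interpret prob_space M by fact
  let ?V = "{(1, 0), (0, 1), - (1, 0), - (0, 1)} :: (real \<times> real) set"
  have [measurable]: "X \<in> borel_measurable M"
    and p: "\<And>v. v \<in> ?V \<Longrightarrow> prob {\<omega> \<in> space M. X \<omega> = v} = 1 / 4"
    using assms(2) by (auto simp: rademacher2_def)
  have "(LINT \<omega>|M. g (X \<omega>)) = (LINT \<omega>|M. (\<Sum>v\<in>?V. indicator {\<omega> \<in> space M. X \<omega> = v} \<omega> *\<^sub>R g v))"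
  proof (rule integral_cong_AE)
    show "AE \<omega> in M. g (X \<omega>) = (\<Sum>v\<in>?V. indicator {\<omega> \<in> space M. X \<omega> = v} \<omega> *\<^sub>R g v)"
      using rademacher2_AE[OF assms(1,2)] AE_space
    proof eventually_elim
      case (elim \<omega>)
      then have "(\<Sum>v\<in>?V. indicator {\<omega> \<in> space M. X \<omega> = v} \<omega> *\<^sub>R g v)
        = (\<Sum>v\<in>?V. if v = X \<omega> then g v else 0)"
        by (intro sum.cong) (auto simp: indicator_def)
      also have "\<dots> = g (X \<omega>)"
        using elim by (subst sum.delta) auto
      finally show ?case by simp
    qed
  qed measurable
  also have "\<dots> = (\<Sum>v\<in>?V. (LINT \<omega>|M. indicator {\<omega> \<in> space M. X \<omega> = v} \<omega> *\<^sub>R g v))"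
    by (rule Bochner_Integration.integral_sum) (auto simp: emeasure_eq_measure)
  also have "\<dots> = (\<Sum>v\<in>?V. (1 / 4) *\<^sub>R g v)"
  proof (intro sum.cong refl)
    fix v assume "v \<in> ?V"
    have "(LINT \<omega>|M. indicator {\<omega> \<in> space M. X \<omega> = v} \<omega> *\<^sub>R g v)
      = (LINT \<omega>|M. indicat_real {\<omega> \<in> space M. X \<omega> = v} \<omega>) *\<^sub>R g v"
      by (rule integral_scaleR_left) (simp add: emeasure_eq_measure)
    also have "\<dots> = (1 / 4) *\<^sub>R g v"
      using p[OF \<open>v \<in> ?V\<close>] by (simp add: Int_absorb2 subset_eq)
    finally show "(LINT \<omega>|M. indicator {\<omega> \<in> space M. X \<omega> = v} \<omega> *\<^sub>R g v) = (1 / 4) *\<^sub>R g v" .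
  qed
  also have "\<dots> = (g (1, 0) + g (0, 1) + g (-1, 0) + g (0, -1)) / 4"
    by (simp add: scaleR_conv_of_real algebra_simps)
  finally show ?thesis .
qed

text \<open>On the four values, the pair of sum and difference of the coordinates runs through all
  four sign pairs with equal weight. These are two independent fair signs, and each contributes a
  cosine.\<close>

lemma rademacher2_char:
  assumes "prob_space M" "rademacher2 M X"
  shows "(LINT \<omega>|M. cis (s * (fst (X \<omega>) + snd (X \<omega>)) + t * (fst (X \<omega>) - snd (X \<omega>))))
    = of_real (cos s * cos t)"
proof -
  have "(LINT \<omega>|M. cis (s * (fst (X \<omega>) + snd (X \<omega>)) + t * (fst (X \<omega>) - snd (X \<omega>))))
    = (cis (s + t) + cis (s - t) + cis (- (s + t)) + cis (- (s - t))) / 4"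
    by (subst rademacher2_expectation[OF assms,
          of "\<lambda>x. cis (s * (fst x + snd x) + t * (fst x - snd x))"])
       (auto intro!: borel_measurable_continuous_onI continuous_intros simp: add.commute)
  also have "\<dots> = of_real (cos s * cos t)"
    by (simp add: complex_eq_iff cos_add cos_diff sin_add sin_diff)
  finally show ?thesis .
qed

lemma cis_sum: "cis (sum f I) = (\<Prod>i\<in>I. cis (f i))"
  by (induction I rule: infinite_finite_induct) (auto simp: cis_mult[symmetric])

lemma iid_rademacher2_char:
  fixes \<alpha> \<beta> :: "nat \<Rightarrow> real"
  assumes "prob_space M" "iid_rademacher2 M \<xi>" "finite I" "I \<subseteq> {1..}"
  shows "(LINT \<omega>|M. cis (\<Sum>i\<in>I. \<alpha> i * (fst (\<xi> i \<omega>) + snd (\<xi> i \<omega>)) + \<beta> i * (fst (\<xi> i \<omega>) - snd (\<xi> i \<omega>))))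
    = of_real (\<Prod>i\<in>I. cos (\<alpha> i) * cos (\<beta> i))"
proof -
  interpret prob_space M by fact
  let ?g = "\<lambda>i x :: real \<times> real. cis (\<alpha> i * (fst x + snd x) + \<beta> i * (fst x - snd x))"
  have r: "rademacher2 M (\<xi> i)" if "i \<in> I" for i
    using assms that by (auto simp: iid_rademacher2_def)
  have "indep_vars (\<lambda>_. borel) \<xi> I"
    using assms by (auto simp: iid_rademacher2_def intro: indep_vars_subset)
  then have ind: "indep_vars (\<lambda>_. borel) (\<lambda>i \<omega>. ?g i (\<xi> i \<omega>)) I"
    by (rule indep_vars_compose2)
      (auto intro!: borel_measurable_continuous_onI continuous_intros)
  have "integrable M (\<lambda>\<omega>. ?g i (\<xi> i \<omega>))" if "i \<in> I" for i
    using ind that by (intro integrable_const_bound[of _ 1]) (auto simp: indep_vars_def)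
  from indep_vars_lebesgue_integral[OF assms(3) ind this]
  have "(LINT \<omega>|M. (\<Prod>i\<in>I. ?g i (\<xi> i \<omega>))) = (\<Prod>i\<in>I. LINT \<omega>|M. ?g i (\<xi> i \<omega>))" .
  also have "\<dots> = (\<Prod>i\<in>I. of_real (cos (\<alpha> i) * cos (\<beta> i)))"
    by (intro prod.cong refl rademacher2_char assms r)
  finally show ?thesis by (simp add: cis_sum)
qed

text \<open>A single null set serves all indices at once, so that almost every path stays on the
  integer lattice.\<close>

lemma iid_rademacher2_AE_Ints:
  assumes "prob_space M" "iid_rademacher2 M \<xi>"
  shows "AE \<omega> in M. \<forall>i\<in>{1..}. fst (\<xi> i \<omega>) \<in> \<int> \<and> snd (\<xi> i \<omega>) \<in> \<int>"
proof (rule AE_ball_countable')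
  fix i :: nat assume "i \<in> {1..}"
  then have "rademacher2 M (\<xi> i)" using assms(2) by (auto simp: iid_rademacher2_def)
  from rademacher2_AE[OF assms(1) this]
  show "AE \<omega> in M. fst (\<xi> i \<omega>) \<in> \<int> \<and> snd (\<xi> i \<omega>) \<in> \<int>"
    by eventually_elim auto
qed auto

section \<open>Probability of a congruence modulo b\<close>

lemma prod_image_le:
  fixes g :: "'b \<Rightarrow> real"
  assumes "finite I" "A \<subseteq> h ` I" "\<And>c. 0 \<le> g c" "\<And>c. g c \<le> 1"
  shows "(\<Prod>i\<in>I. g (h i)) \<le> (\<Prod>c\<in>A. g c)"
proof -
  obtain J where J: "J \<subseteq> I" "inj_on h J" "A = h ` J"
    using assms(2) unfolding subset_image_inj by auto
  have "(\<Prod>i\<in>I. g (h i)) = (\<Prod>i\<in>I - J. g (h i)) * (\<Prod>i\<in>J. g (h i))"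
    using J(1) assms(1) by (rule prod.subset_diff)
  also have "\<dots> \<le> 1 * (\<Prod>i\<in>J. g (h i))"
    using assms by (intro mult_right_mono prod_le_1 prod_nonneg) auto
  finally show ?thesis using J by (simp add: prod.reindex)
qed

text \<open>The indicator of \<open>E\<close> is the average of the characters of (Z/b) x (Z/b) at
  \<open>(U - u, V - v)\<close>. Taking expectations, the triangle inequality leaves cosine
  products, and the sums over the two frequencies separate.\<close>

lemma prob_lattice_le:
  fixes a :: "nat \<Rightarrow> nat" and b :: nat and u v :: int
  assumes "prob_space M" "iid_rademacher2 M \<xi>" "finite I" "I \<subseteq> {1..}"
    and "A \<subseteq> a ` I" "A \<subseteq> {1..<b}" "card A > 0"
  defines "U \<equiv> \<lambda>\<omega>. \<Sum>i\<in>I. real (a i) * (fst (\<xi> i \<omega>) + snd (\<xi> i \<omega>))"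
    and "V \<equiv> \<lambda>\<omega>. \<Sum>i\<in>I. real (a i) * (fst (\<xi> i \<omega>) - snd (\<xi> i \<omega>))"
  defines "E \<equiv> {\<omega> \<in> space M. \<exists>p q :: int. U \<omega> = of_int (u + int b * p) \<and> V \<omega> = of_int (v + int b * q)}"
  shows "E \<in> sets M" and "measure M E \<le> (20 / card A)\<^sup>2"
proof -
  interpret prob_space M by fact
  have b: "b > 0" using assms(6,7) by (cases "b = 0") auto
  have xi: "\<xi> i \<in> borel_measurable M" if "i \<in> I" for i
    using assms(2,4) that by (auto simp: iid_rademacher2_def rademacher2_def)
  have xi1[measurable]: "(\<lambda>\<omega>. fst (\<xi> i \<omega>)) \<in> borel_measurable M" if "i \<in> I" for i
    by (rule measurable_compose[OF xi[OF that]])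
      (intro borel_measurable_continuous_onI continuous_intros)
  have xi2[measurable]: "(\<lambda>\<omega>. snd (\<xi> i \<omega>)) \<in> borel_measurable M" if "i \<in> I" for i
    by (rule measurable_compose[OF xi[OF that]])
      (intro borel_measurable_continuous_onI continuous_intros)
  have [measurable]: "U \<in> borel_measurable M" "V \<in> borel_measurable M"
    unfolding U_def V_def by measurable
  show E[measurable]: "E \<in> sets M"
    unfolding E_def by measurable
  define \<theta> where "\<theta> s = 2 * pi * real s / real b" for s :: nat
  define f where "f s t \<omega> = cis (\<theta> s * (U \<omega> - u) + \<theta> t * (V \<omega> - v))" for s t \<omega>
  have [measurable]: "f s t \<in> borel_measurable M" for s t
    unfolding f_def
    by (rule measurable_compose[where N = borel and g = cis])
      (auto intro!: borel_measurable_continuous_onI continuous_intros)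
  have int_f: "integrable M (f s t)" for s t
    by (intro integrable_const_bound[of _ 1]) (auto simp: f_def)
  have roots: "(\<Sum>s<b. cis (\<theta> s * (of_int n - of_int m))) = (if int b dvd n - m then of_nat b else 0)" for n m
    using sum_cis_roots_of_unity[OF b, of "n - m"] by (simp add: \<theta>_def)
  \<comment> \<open>Orthogonality in both coordinates; it needs integral \<open>U\<close> and
    \<open>V\<close>, hence holds only almost everywhere.\<close>
  have "AE \<omega> in M. (\<Sum>s<b. \<Sum>t<b. f s t \<omega>) = of_real ((real b)\<^sup>2 * indicator E \<omega>)"
    using iid_rademacher2_AE_Ints[OF assms(1,2)] AE_space
  proof eventually_elim
    case (elim \<omega>)
    have "U \<omega> \<in> \<int>" "V \<omega> \<in> \<int>"
      using elim(1) assms(4) unfolding U_def V_def by (auto intro!: Ints_sum Ints_mult)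
    then obtain n m where nm: "U \<omega> = of_int n" "V \<omega> = of_int m" by (auto elim!: Ints_cases)
    have "\<omega> \<in> E \<longleftrightarrow> int b dvd n - u \<and> int b dvd m - v"
      unfolding E_def mem_Collect_eq nm of_int_eq_iff using elim(2) by (auto simp: dvd_def algebra_simps)
    moreover have "(\<Sum>s<b. \<Sum>t<b. f s t \<omega>)
      = (\<Sum>s<b. cis (\<theta> s * (of_int n - of_int u))) * (\<Sum>t<b. cis (\<theta> t * (of_int m - of_int v)))"
      unfolding f_def nm by (simp add: sum_product cis_mult)
    ultimately show ?case
      unfolding roots by (auto simp: power2_eq_square)
  qed
  then have "(LINT \<omega>|M. (\<Sum>s<b. \<Sum>t<b. f s t \<omega>)) = (LINT \<omega>|M. of_real ((real b)\<^sup>2 * indicator E \<omega>))"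
    by (intro integral_cong_AE) auto
  also have "\<dots> = of_real ((real b)\<^sup>2 * prob E)"
    using E sets.sets_into_space[OF E]
    by (subst integral_complex_of_real) (simp add: Int_absorb2)
  also have "(LINT \<omega>|M. (\<Sum>s<b. \<Sum>t<b. f s t \<omega>)) = (\<Sum>s<b. \<Sum>t<b. LINT \<omega>|M. f s t \<omega>)"
    using int_f by (simp add: Bochner_Integration.integral_sum Bochner_Integration.integrable_sum)
  finally have eq: "(\<Sum>s<b. \<Sum>t<b. LINT \<omega>|M. f s t \<omega>) = of_real ((real b)\<^sup>2 * prob E)" .
  have "(real b)\<^sup>2 * prob E = norm (\<Sum>s<b. \<Sum>t<b. LINT \<omega>|M. f s t \<omega>)"
    unfolding eq norm_of_real by simp
  also have "\<dots> \<le> (\<Sum>s<b. \<Sum>t<b. norm (LINT \<omega>|M. f s t \<omega>))"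
    by (intro order.trans[OF norm_sum] sum_mono order_refl)
  also have "\<dots> \<le> (\<Sum>s<b. \<Sum>t<b. (\<Prod>c\<in>A. \<bar>cos (\<theta> s * real c)\<bar>) * (\<Prod>c\<in>A. \<bar>cos (\<theta> t * real c)\<bar>))"
  proof (intro sum_mono)
    fix s t
    \<comment> \<open>The residues \<open>u\<close> and \<open>v\<close> enter only through a factor
      of modulus 1, so the bound is uniform in them.\<close>
    have "f s t \<omega> = cis (- (\<theta> s * u + \<theta> t * v)) *
      cis (\<Sum>i\<in>I. \<theta> s * real (a i) * (fst (\<xi> i \<omega>) + snd (\<xi> i \<omega>))
        + \<theta> t * real (a i) * (fst (\<xi> i \<omega>) - snd (\<xi> i \<omega>)))" for \<omega>
      unfolding f_def U_def V_def cis_mult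
      by (intro arg_cong[where f = cis])
        (simp add: sum.distrib sum_distrib_left mult.assoc right_diff_distrib)
    then have "(LINT \<omega>|M. f s t \<omega>) = cis (- (\<theta> s * u + \<theta> t * v)) *
      of_real (\<Prod>i\<in>I. cos (\<theta> s * real (a i)) * cos (\<theta> t * real (a i)))"
      using iid_rademacher2_char[OF assms(1-4), of "\<lambda>i. \<theta> s * real (a i)" "\<lambda>i. \<theta> t * real (a i)"]
      by (simp only: integral_mult_right_zero)
    then have "norm (LINT \<omega>|M. f s t \<omega>)
      = (\<Prod>i\<in>I. \<bar>cos (\<theta> s * real (a i))\<bar>) * (\<Prod>i\<in>I. \<bar>cos (\<theta> t * real (a i))\<bar>)"
      by (simp add: norm_mult abs_mult abs_prod prod.distrib del: of_real_prod of_real_mult)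
    also have "\<dots> \<le> (\<Prod>c\<in>A. \<bar>cos (\<theta> s * real c)\<bar>) * (\<Prod>c\<in>A. \<bar>cos (\<theta> t * real c)\<bar>)"
      by (intro mult_mono prod_nonneg prod_image_le[OF assms(3,5), where g = "\<lambda>c. \<bar>cos (_ * real c)\<bar>"])
        auto
    finally show "norm (LINT \<omega>|M. f s t \<omega>)
      \<le> (\<Prod>c\<in>A. \<bar>cos (\<theta> s * real c)\<bar>) * (\<Prod>c\<in>A. \<bar>cos (\<theta> t * real c)\<bar>)" .
  qed
  \<comment> \<open>The square arising here is what makes the series over the groups
    converge.\<close>
  also have "\<dots> = (\<Sum>s<b. \<Prod>c\<in>A. \<bar>cos (\<theta> s * real c)\<bar>)\<^sup>2"
    by (simp add: power2_eq_square sum_product)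
  also have "\<dots> \<le> (20 * real b / card A)\<^sup>2"
    using sum_prod_abs_cos_le[OF assms(6,7)]
    by (intro power_mono) (auto simp: \<theta>_def intro!: sum_nonneg prod_nonneg)
  also have "\<dots> = (real b)\<^sup>2 * (20 / card A)\<^sup>2"
    by (simp add: power_mult_distrib power_divide)
  finally show "measure M E \<le> (20 / card A)\<^sup>2"
    by (rule mult_left_le_imp_le) (use b in simp)
qed

section \<open>Visits within a group of equal steps, and Borel-Cantelli over the groups\<close>

text \<open>\<open>enumerate\<close> is strictly increasing and starts at index 0, so the index of a
  group is the number of smaller step sizes.\<close>

lemma card_less_enumerate:
  fixes B :: "nat set"
  assumes "infinite B"
  shows "card {c \<in> B. c < enumerate B k} = k"
proof -
  have "{c \<in> B. c < enumerate B k} = enumerate B ` {..<k}"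
  proof (intro equalityI subsetI)
    fix c assume c: "c \<in> {c \<in> B. c < enumerate B k}"
    then obtain j where "enumerate B j = c" using enumerate_Ex assms by blast
    then show "c \<in> enumerate B ` {..<k}" using c assms by auto
  qed (use assms in \<open>auto simp: enumerate_in_set\<close>)
  then show ?thesis
    using assms by (simp add: card_image inj_enumerate inj_on_subset[OF _ subset_UNIV])
qed

text \<open>All visits during the group with step \<open>b\<close> are covered by one event about
  the steps smaller than \<open>b\<close>: the sum of these must agree with the target modulo
  \<open>b\<close>, whatever the time of the visit.\<close>

lemma prob_visit_block_le:
  fixes a :: "nat \<Rightarrow> nat" and b :: nat and p q :: int
  assumes "prob_space M" "iid_rademacher2 M \<xi>"
    and pos: "\<And>n. n \<ge> 1 \<Longrightarrow> a n > 0" and mono: "mono_on {1..} a"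
    and lim: "filterlim a at_top sequentially"
    and card: "card {c \<in> a ` {1..}. c < b} > 0"
  defines "E \<equiv> {\<omega> \<in> space M. \<exists>n\<ge>1. a n = b \<and>
    rademacher_walk (\<lambda>i. real (a i)) \<xi> n \<omega> = (of_int p, of_int q)}"
  shows "measure M E \<le> (20 / card {c \<in> a ` {1..}. c < b})\<^sup>2"
proof -
  interpret prob_space M by fact
  define I where "I = {i\<in>{1..}. a i < b}"
  define A where "A = {c \<in> a ` {1..}. c < b}"
  have "\<forall>\<^sub>F n in sequentially. b \<le> a n" using lim by (simp add: filterlim_at_top)
  then obtain N where "\<And>n. n \<ge> N \<Longrightarrow> b \<le> a n" by (auto simp: eventually_sequentially)
  \<comment> \<open>Divergence of \<open>a\<close> is what leaves only finitely many times before
    the group.\<close>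
  then have "I \<subseteq> {..<N}" unfolding I_def by (force simp: not_le[symmetric])
  then have I: "finite I" "I \<subseteq> {1..}" "A \<subseteq> a ` I" "A \<subseteq> {1..<b}" "card A > 0"
    using card pos by (auto simp: I_def A_def Suc_le_eq intro: finite_subset)
  let ?F = "{\<omega> \<in> space M. \<exists>r s :: int.
    (\<Sum>i\<in>I. real (a i) * (fst (\<xi> i \<omega>) + snd (\<xi> i \<omega>))) = of_int ((p + q) + int b * r) \<and>
    (\<Sum>i\<in>I. real (a i) * (fst (\<xi> i \<omega>) - snd (\<xi> i \<omega>))) = of_int ((p - q) + int b * s)}"
  note F = prob_lattice_le[OF assms(1,2) I, of "p + q" "p - q"]
  have "prob E \<le> prob ?F"
  proof (rule finite_measure_mono_AE)
    show "AE \<omega> in M. \<omega> \<in> E \<longrightarrow> \<omega> \<in> ?F"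
      using iid_rademacher2_AE_Ints[OF assms(1,2)] AE_space
    proof eventually_elim
      case (elim \<omega>)
      show ?case
      proof
        assume "\<omega> \<in> E"
        then obtain n where n: "n \<ge> 1" "a n = b"
          and S: "rademacher_walk (\<lambda>i. real (a i)) \<xi> n \<omega> = (of_int p, of_int q)"
          by (auto simp: E_def)
        define J where "J = {i\<in>{1..n}. a i = b}"
        have le: "a i \<le> b" if "1 \<le> i" "i \<le> n" for i
          using mono_onD[OF mono, of i n] that n by auto
        have less: "i \<le> n" if "1 \<le> i" "a i < b" for i
          using mono_onD[OF mono, of n i] that n by (cases "i \<le> n") auto
        \<comment> \<open>By monotonicity, the times up to \<open>n\<close> are all times of smaller
          steps together with an initial piece of the current group.\<close>
        have un: "{1..n} = I \<union> J"
        proof (rule set_eqI)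
          show "i \<in> {1..n} \<longleftrightarrow> i \<in> I \<union> J" for i
            using le[of i] less[of i] by (cases "a i" b rule: linorder_cases) (auto simp: I_def J_def)
        qed
        have split: "(\<Sum>i=1..n. real (a i) * g i) = (\<Sum>i\<in>I. real (a i) * g i) + real b * (\<Sum>i\<in>J. g i)"
          for g :: "nat \<Rightarrow> real"
        proof -
          have "(\<Sum>i=1..n. real (a i) * g i) = (\<Sum>i\<in>I. real (a i) * g i) + (\<Sum>i\<in>J. real (a i) * g i)"
            unfolding un using I(1) by (intro sum.union_disjoint) (auto simp: I_def J_def)
          also have "(\<Sum>i\<in>J. real (a i) * g i) = real b * (\<Sum>i\<in>J. g i)"
            unfolding sum_distrib_left by (intro sum.cong) (auto simp: J_def)
          finally show ?thesis .
        qed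
        have "fst (rademacher_walk (\<lambda>i. real (a i)) \<xi> n \<omega>) = (\<Sum>i=1..n. real (a i) * fst (\<xi> i \<omega>))"
          "snd (rademacher_walk (\<lambda>i. real (a i)) \<xi> n \<omega>) = (\<Sum>i=1..n. real (a i) * snd (\<xi> i \<omega>))"
          by (simp_all add: rademacher_walk_def fst_sum snd_sum)
        then have pq: "of_int (p + q) = (\<Sum>i=1..n. real (a i) * (fst (\<xi> i \<omega>) + snd (\<xi> i \<omega>)))"
          "of_int (p - q) = (\<Sum>i=1..n. real (a i) * (fst (\<xi> i \<omega>) - snd (\<xi> i \<omega>)))"
          unfolding S by (simp_all add: distrib_left right_diff_distrib sum.distrib sum_subtractf)
        have "(\<Sum>i\<in>J. fst (\<xi> i \<omega>) + snd (\<xi> i \<omega>)) \<in> \<int>" "(\<Sum>i\<in>J. fst (\<xi> i \<omega>) - snd (\<xi> i \<omega>)) \<in> \<int>"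
          using elim(1) by (auto simp: J_def intro!: Ints_sum)
        then obtain r s where rs: "(\<Sum>i\<in>J. fst (\<xi> i \<omega>) + snd (\<xi> i \<omega>)) = of_int r"
          "(\<Sum>i\<in>J. fst (\<xi> i \<omega>) - snd (\<xi> i \<omega>)) = of_int s" by (auto elim!: Ints_cases)
        \<comment> \<open>The contribution \<open>b * r\<close> of the current group moves to the
          other side, hence the negated witnesses.\<close>
        have "(\<Sum>i\<in>I. real (a i) * (fst (\<xi> i \<omega>) + snd (\<xi> i \<omega>))) = of_int ((p + q) + int b * (- r))"
          "(\<Sum>i\<in>I. real (a i) * (fst (\<xi> i \<omega>) - snd (\<xi> i \<omega>))) = of_int ((p - q) + int b * (- s))"
          using pq unfolding split rs by simp_all
        then show "\<omega> \<in> ?F" using elim(2) by blast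
      qed
    qed
  qed (rule F(1))
  also have "\<dots> \<le> (20 / card A)\<^sup>2" by (rule F(2))
  finally show ?thesis by (simp add: A_def)
qed

theorem theorem1:
  fixes M :: "'w measure" and a :: "nat \<Rightarrow> nat" and \<xi> :: "nat \<Rightarrow> 'w \<Rightarrow> real \<times> real"
  assumes "prob_space M"
    and "iid_rademacher2 M \<xi>"
    and "\<And>n. n \<ge> 1 \<Longrightarrow> a n > 0"
    and "mono_on {1..} a"
    and "filterlim a at_top sequentially"
  shows "transient M (rademacher_walk (\<lambda>i. real (a i)) \<xi>)"
proof -
  interpret prob_space M by fact
  define S where "S = rademacher_walk (\<lambda>i. real (a i)) \<xi>"
  define B where "B = a ` {1..}"
  have "infinite B"
  proof
    assume "finite B"
    have "\<forall>\<^sub>F n in sequentially. Suc (Max B) \<le> a n"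
      using assms(5) by (simp add: filterlim_at_top)
    then have "\<forall>\<^sub>F n in sequentially. Suc (Max B) \<le> a n \<and> n \<ge> 1"
      by (intro eventually_conj eventually_ge_at_top)
    then obtain n where "Suc (Max B) \<le> a n" "n \<ge> 1" by (auto simp: eventually_sequentially)
    then show False using Max_ge[OF \<open>finite B\<close>, of "a n"] by (auto simp: B_def)
  qed
  define E where "E x k = {\<omega> \<in> space M. \<exists>n\<ge>1. a n = enumerate B k \<and>
    S n \<omega> = (of_int (fst x), of_int (snd x))}" for x :: "int \<times> int" and k
  have xi: "\<xi> i \<in> borel_measurable M" if "i \<ge> 1" for i
    using assms(2) that by (auto simp: iid_rademacher2_def rademacher2_def)
  have S_meas[measurable]: "S n \<in> borel_measurable M" for n
    unfolding S_def rademacher_walk_def using xi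
    by (intro borel_measurable_sum borel_measurable_scaleR) auto
  have E_sets: "E x k \<in> sets M" for x k
    unfolding E_def by measurable
  \<comment> \<open>There are countably many lattice points, so the quantifier over \<open>x\<close>
    may stand inside the almost sure statement.\<close>
  have "AE \<omega> in M. \<forall>x. \<forall>\<^sub>F k in sequentially. \<omega> \<in> space M - E x k"
  proof (subst AE_all_countable, intro allI borel_cantelli_AE1 E_sets)
    fix x
    show "summable (\<lambda>k. prob (E x k))"
    proof (rule summable_comparison_test')
      show "summable (\<lambda>k. 400 * (1 / real k ^ 2))"
        by (intro summable_mult inverse_power_summable[of 2, unfolded inverse_eq_divide]) simp
      \<comment> \<open>Group 0 has no smaller step sizes and hence no bound; the constant 400 is
        the square of 20.\<close>
      fix k :: nat assume k: "k \<ge> 1"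
      then show "norm (prob (E x k)) \<le> 400 * (1 / real k ^ 2)"
        using prob_visit_block_le[OF assms, of "enumerate B k" "fst x" "snd x"]
          card_less_enumerate[OF \<open>infinite B\<close>, of k]
        unfolding B_def[symmetric] S_def[symmetric] E_def[symmetric]
        by (simp add: power_divide)
    qed
  qed (simp add: emeasure_eq_measure)
  then have "AE \<omega> in M. filterlim (\<lambda>n. norm (S n \<omega>)) at_top sequentially"
    using iid_rademacher2_AE_Ints[OF assms(1,2)]
  proof eventually_elim
    case (elim \<omega>)
    show ?case
    proof (subst filterlim_at_top, intro allI)
      fix R :: real
      \<comment> \<open>A finite box containing every lattice point of norm below \<open>R\<close>;
        finiteness yields one group index \<open>K\<close> after which no point of the box is
        visited.\<close>
      define P where "P = {- \<lceil>\<bar>R\<bar>\<rceil>..\<lceil>\<bar>R\<bar>\<rceil>} \<times> {- \<lceil>\<bar>R\<bar>\<rceil>..\<lceil>\<bar>R\<bar>\<rceil>}"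
      have "\<forall>\<^sub>F k in sequentially. \<forall>x\<in>P. \<omega> \<in> space M - E x k"
        using elim(1) by (intro eventually_ball_finite) (auto simp: P_def)
      then obtain K where K: "\<And>k x. k \<ge> K \<Longrightarrow> x \<in> P \<Longrightarrow> \<omega> \<in> space M - E x k"
        by (auto simp: eventually_sequentially)
      \<comment> \<open>Back from groups to times: since \<open>a\<close> diverges, every late time
        belongs to a group of index at least \<open>K\<close>.\<close>
      have "\<forall>\<^sub>F n in sequentially. enumerate B K \<le> a n"
        using assms(5) by (simp add: filterlim_at_top)
      then show "\<forall>\<^sub>F n in sequentially. R \<le> norm (S n \<omega>)"
        using eventually_ge_at_top[of 1]
      proof eventually_elim
        case (elim n)
        then have "a n \<in> B" by (auto simp: B_def)
        then obtain k where k: "enumerate B k = a n"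
          using enumerate_Ex \<open>infinite B\<close> by blast
        then have "k \<ge> K" using elim \<open>infinite B\<close> by (metis enumerate_mono_le_iff)
        have "fst (S n \<omega>) \<in> \<int>" "snd (S n \<omega>) \<in> \<int>"
          using \<open>\<forall>i\<in>{1..}. fst (\<xi> i \<omega>) \<in> \<int> \<and> snd (\<xi> i \<omega>) \<in> \<int>\<close>
          by (auto simp: S_def rademacher_walk_def fst_sum snd_sum intro!: Ints_sum Ints_mult)
        then obtain p q where pq: "S n \<omega> = (of_int p, of_int q)"
          by (metis Ints_cases prod.collapse)
        show "R \<le> norm (S n \<omega>)"
        proof (rule ccontr)
          assume "\<not> R \<le> norm (S n \<omega>)"
          moreover have "\<bar>real_of_int p\<bar> \<le> norm (S n \<omega>)" "\<bar>real_of_int q\<bar> \<le> norm (S n \<omega>)"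
            using norm_fst_le[of "real_of_int p" "real_of_int q"]
              norm_snd_le[of "real_of_int q" "real_of_int p"] by (simp_all add: pq)
          ultimately have "\<bar>real_of_int p\<bar> \<le> \<bar>R\<bar>" "\<bar>real_of_int q\<bar> \<le> \<bar>R\<bar>" by auto
          then have "(p, q) \<in> P" unfolding P_def by (auto; linarith)
          then show False
            using K[OF \<open>k \<ge> K\<close>, of "(p, q)"] k pq elim by (auto simp: E_def)
        qed
      qed
    qed
  qed
  then show ?thesis by (simp add: transient_def S_def)
qed

end
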